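(* Let $(\mathfrak{A},\mathfrak{A}_0)$ be a quasi *-algebra, let $\mathcal{M}\subset\mathcal{I}_{\mathfrak{A}_0}(\mathfrak{A})$ be sufficient, and let $a\in\mathfrak{A}$. The following are equivalent: (i) $a$ is $\mathcal{K}_{\mathcal{M}}$-bounded; (ii) $a$ is $\mathcal{M}$-bounded, i.e. there exists $\gamma_a>0$ such that $|\varphi(ax,y)|\le\gamma_a\,\varphi(x,x)^{1/2}\varphi(y,y)^{1/2}$ for all $x,y\in\mathfrak{A}_0$ and every $\varphi\in\mathcal{M}$; (iii) there exists $\gamma'_a>0$ such that $\varphi(ax,ax)\le\gamma'_a\,\varphi(x,x)$ for all $x\in\mathfrak{A}_0$ and every $\varphi\in\mathcal{M}$; (iv) there exists $\gamma''_a>0$ such that $|\varphi(ax,x)|\le\gamma''_a\,\varphi(x,x)$ for all $x\in\mathfrak{A}_0$ and every $\varphi\in\mathcal{M}$.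
   Context: Vector spaces are complex; sesquilinear forms are linear in the first variable. A quasi *-algebra $(\mathfrak{A},\mathfrak{A}_0)$ is a vector space $\mathfrak{A}$ with a *-algebra $\mathfrak{A}_0$ contained in $\mathfrak{A}$ as a subspace, such that: (i) $\mathfrak{A}$ carries an involution $a\mapsto a^*$ extending that of $\mathfrak{A}_0$; (ii) $\mathfrak{A}$ is a bimodule over $\mathfrak{A}_0$, with module multiplications extending the multiplication of $\mathfrak{A}_0$; in particular $(xa)y=x(ay)$ and $a(xy)=(ax)y$ for $a\in\mathfrak{A}$, $x,y\in\mathfrak{A}_0$; (iii) $(ax)^*=x^*a^*$ for $a\in\mathfrak{A}$, $x\in\mathfrak{A}_0$. It is always assumed that ($ax=0$ for all $x\in\mathfrak{A}_0$) implies $a=0$, and ($ax=0$ for all $a\in\mathfrak{A}$) implies $x=0$. $\mathcal{Q}_{\mathfrak{A}_0}(\mathfrak{A})$ is the set of sesquilinear forms $\varphi$ on $\mathfrak{A}\times\mathfrak{A}$ with $\varphi(a,a)\ge0$ for $a\in\mathfrak{A}$ and $\varphi(ax,y)=\varphi(x,a^*y)$ for $a\in\mathfrak{A}$, $x,y\in\mathfrak{A}_0$. For such $\varphi$, $N_\varphi=\{a:\varphi(a,a)=0\}$, $\lambda_\varphi:\mathfrak{A}\to\mathfrak{A}/N_\varphi$ is the quotient map, and $\mathcal{H}_\varphi$ is the Hilbert space completion of $\lambda_\varphi(\mathfrak{A})$ for $\langle\lambda_\varphi(a)|\lambda_\varphi(b)\rangle=\varphi(a,b)$. $\mathcal{I}_{\mathfrak{A}_0}(\mathfrak{A})$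 is the set of $\varphi\in\mathcal{Q}_{\mathfrak{A}_0}(\mathfrak{A})$ with $\lambda_\varphi(\mathfrak{A}_0)$ dense in $\mathcal{H}_\varphi$. For $x\in\mathfrak{A}_0$, $\varphi^x(a,b):=\varphi(ax,bx)$. A set $\mathcal{M}\subset\mathcal{I}_{\mathfrak{A}_0}(\mathfrak{A})$ is balanced if $\varphi\in\mathcal{M}$, $x\in\mathfrak{A}_0$ imply $\varphi^x\in\mathcal{M}$; it is sufficient if it is balanced and for every $a\in\mathfrak{A}\setminus\{0\}$ there is $\varphi\in\mathcal{M}$ with $\varphi(a,a)>0$. For $a\in\mathfrak{A}$ put $\Re(a)=\frac12(a+a^* )$, $\Im(a)=\frac1{2i}(a-a^* )$. The element $a$ is $\mathcal{K}_{\mathcal{M}}$-bounded if there is $\gamma\ge0$ such that $\pm\varphi(\Re(a)x,x)\le\gamma\varphi(x,x)$ and $\pm\varphi(\Im(a)x,x)\le\gamma\varphi(x,x)$ for all $\varphi\in\mathcal{M}$, $x\in\mathfrak{A}_0$. *)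

theory Defs
  imports "HOL-Analysis.Analysis" "HOL-Library.Complex_Order"
begin

section \<open>Completion of a metric space by Cauchy sequences\<close>

context Metric_space
begin

definition completion_rel :: "((nat \<Rightarrow> 'a) \<times> (nat \<Rightarrow> 'a)) set" where
  "completion_rel =
     {(u, v). MCauchy u \<and> MCauchy v \<and> (\<lambda>n. d (u n) (v n)) \<longlonglongrightarrow> 0}"

definition completion :: "(nat \<Rightarrow> 'a) set set" where
  "completion = Collect MCauchy // completion_rel"

text \<open>The locale \<^locale>\<open>Metric_space\<close> requires nonnegativity and symmetry also outside the
  carrier, so distances are set to \<open>0\<close> there.\<close>

definition completion_dist :: "(nat \<Rightarrow> 'a) set \<Rightarrow> (nat \<Rightarrow> 'a) set \<Rightarrow> real" where
  "completion_dist U V =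
     (if U \<in> completion \<and> V \<in> completion
      then THE r. \<exists>u\<in>U. \<exists>v\<in>V. (\<lambda>n. d (u n) (v n)) \<longlonglongrightarrow> r
      else 0)"

definition completion_embed :: "'a \<Rightarrow> (nat \<Rightarrow> 'a) set" where
  "completion_embed x = completion_rel `` {\<lambda>n. x}"

lemma quadrangle:
  assumes "x \<in> M" "y \<in> M" "x' \<in> M" "y' \<in> M"
  shows "\<bar>d x y - d x' y'\<bar> \<le> d x x' + d y y'"
proof -
  have "d x y \<le> d x x' + d x' y' + d y' y" "d x' y' \<le> d x' x + d x y + d y y'"
    using assms triangle by (meson add_mono order_refl order_trans add_left_mono add_right_mono)+
  thus ?thesis using commute[of x x'] commute[of y y'] by linarith
qed

lemma MCauchy_in: "MCauchy u \<Longrightarrow> u n \<in> M"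
  by (auto simp: MCauchy_def)

lemma equiv_completion_rel: "equiv (Collect MCauchy) completion_rel"
proof (rule equivI)
  show "completion_rel \<subseteq> Collect MCauchy \<times> Collect MCauchy"
    by (auto simp: completion_rel_def)
  show "refl_on (Collect MCauchy) completion_rel"
    by (auto simp: completion_rel_def refl_on_def MCauchy_in)
  show "sym completion_rel"
    by (auto simp: completion_rel_def sym_def commute)
  show "trans completion_rel"
  proof (rule transI)
    fix u v w assume *: "(u, v) \<in> completion_rel" "(v, w) \<in> completion_rel"
    then have "(\<lambda>n. d (u n) (v n) + d (v n) (w n)) \<longlonglongrightarrow> 0 + 0"
      unfolding completion_rel_def by (intro tendsto_add) auto
    then have "(\<lambda>n. d (u n) (w n)) \<longlonglongrightarrow> 0"
      using * by (intro tendsto_sandwich[of "\<lambda>_. 0" "\<lambda>n. d (u n) (w n)" sequentially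
            "\<lambda>n. d (u n) (v n) + d (v n) (w n)"])
        (auto simp: completion_rel_def MCauchy_in intro!: always_eventually triangle)
    with * show "(u, w) \<in> completion_rel" by (auto simp: completion_rel_def)
  qed
qed

lemma dist_convergent:
  assumes "MCauchy u" "MCauchy v"
  shows "convergent (\<lambda>n. d (u n) (v n))"
proof (rule Cauchy_convergent, rule metric_CauchyI)
  fix e :: real assume "e > 0"
  then obtain N1 N2 where
    N1: "\<And>n n'. N1 \<le> n \<Longrightarrow> N1 \<le> n' \<Longrightarrow> d (u n) (u n') < e / 2" and
    N2: "\<And>n n'. N2 \<le> n \<Longrightarrow> N2 \<le> n' \<Longrightarrow> d (v n) (v n') < e / 2"
    using assms unfolding MCauchy_def by (meson half_gt_zero)
  show "\<exists>N. \<forall>m\<ge>N. \<forall>n\<ge>N. dist (d (u m) (v m)) (d (u n) (v n)) < e"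
  proof (intro exI[of _ "max N1 N2"] allI impI)
    fix m n assume "m \<ge> max N1 N2" "n \<ge> max N1 N2"
    then have "d (u m) (u n) < e/2" "d (v m) (v n) < e/2" using N1 N2 by auto
    moreover have "\<bar>d (u m) (v m) - d (u n) (v n)\<bar> \<le> d (u m) (u n) + d (v m) (v n)"
      using assms by (intro quadrangle MCauchy_in)
    ultimately show "dist (d (u m) (v m)) (d (u n) (v n)) < e" by (simp add: dist_real_def)
  qed
qed

lemma dist_limit_cong:
  assumes "(u, u') \<in> completion_rel" "(v, v') \<in> completion_rel"
    and "(\<lambda>n. d (u n) (v n)) \<longlonglongrightarrow> r"
  shows "(\<lambda>n. d (u' n) (v' n)) \<longlonglongrightarrow> r"
proof -
  have "(\<lambda>n. d (u n) (u' n) + d (v n) (v' n)) \<longlonglongrightarrow> 0 + 0"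
    using assms unfolding completion_rel_def by (intro tendsto_add) auto
  then have "(\<lambda>n. d (u n) (v n) - d (u' n) (v' n)) \<longlonglongrightarrow> 0"
    using assms by (intro Lim_null_comparison[of "\<lambda>n. d (u n) (v n) - d (u' n) (v' n)"
          "\<lambda>n. d (u n) (u' n) + d (v n) (v' n)"])
      (auto simp: completion_rel_def MCauchy_in intro!: always_eventually quadrangle)
  from tendsto_diff[OF assms(3) this] show ?thesis by simp
qed

lemma completionE:
  assumes "U \<in> completion"
  obtains u where "MCauchy u" "u \<in> U" "U = completion_rel `` {u}"
  using assms equiv_completion_rel unfolding completion_def
  by (metis (no_types, lifting) equiv_class_self mem_Collect_eq quotientE)

lemma completion_dist_eqI:
  assumes "U \<in> completion" "V \<in> completion" "u \<in> U" "v \<in> V"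
    and lim: "(\<lambda>n. d (u n) (v n)) \<longlonglongrightarrow> r"
  shows "completion_dist U V = r"
proof -
  have rel: "(u, u') \<in> completion_rel" if "u' \<in> U" for u'
    using assms(1,3) that equiv_completion_rel unfolding completion_def
    by (meson quotient_eq_iff)
  have rel': "(v, v') \<in> completion_rel" if "v' \<in> V" for v'
    using assms(2,4) that equiv_completion_rel unfolding completion_def
    by (meson quotient_eq_iff)
  have "(THE r. \<exists>u\<in>U. \<exists>v\<in>V. (\<lambda>n. d (u n) (v n)) \<longlonglongrightarrow> r) = r"
    using assms(3,4) lim dist_limit_cong[OF rel rel' lim] LIMSEQ_unique
    by (intro the_equality) blast+
  with assms(1,2) show ?thesis by (simp add: completion_dist_def)
qed

lemma completion_dist_lim:
  assumes "U \<in> completion" "V \<in> completion" "u \<in> U" "v \<in> V"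
  shows "(\<lambda>n. d (u n) (v n)) \<longlonglongrightarrow> completion_dist U V"
proof -
  have "MCauchy u" "MCauchy v"
    using assms by (auto elim!: completionE simp: completion_rel_def)
  then obtain r where "(\<lambda>n. d (u n) (v n)) \<longlonglongrightarrow> r"
    using dist_convergent convergent_def by blast
  with completion_dist_eqI[OF assms] show ?thesis by simp
qed

lemma Metric_space_completion: "Metric_space completion completion_dist"
proof
  show nn: "0 \<le> completion_dist U V" for U V
  proof (cases "U \<in> completion \<and> V \<in> completion")
    case True
    then obtain u v where "u \<in> U" "v \<in> V" by (meson completionE)
    with True have "(\<lambda>n. d (u n) (v n)) \<longlonglongrightarrow> completion_dist U V" by (simp add: completion_dist_lim)
    then show ?thesis by (rule LIMSEQ_le_const) auto
  qed (auto simp: completion_dist_def)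
  show "completion_dist U V = completion_dist V U" for U V
    unfolding completion_dist_def by (subst commute) (auto intro!: arg_cong[where f=The])
  show "completion_dist U V = 0 \<longleftrightarrow> U = V" if UV: "U \<in> completion" "V \<in> completion" for U V
  proof -
    obtain u v where uv: "MCauchy u" "u \<in> U" "MCauchy v" "v \<in> V"
      using UV by (meson completionE)
    note lim = completion_dist_lim[OF UV uv(2,4)]
    have "completion_dist U V = 0 \<longleftrightarrow> (u, v) \<in> completion_rel"
      using lim uv LIMSEQ_unique unfolding completion_rel_def by auto
    also have "\<dots> \<longleftrightarrow> U = V"
      using UV uv equiv_completion_rel unfolding completion_def by (meson quotient_eq_iff)
    finally show ?thesis .
  qed
  show "completion_dist U W \<le> completion_dist U V + completion_dist V W"
    if UVW: "U \<in> completion" "V \<in> completion" "W \<in> completion" for U V W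
  proof -
    obtain u v w where uvw: "MCauchy u" "u \<in> U" "MCauchy v" "v \<in> V" "MCauchy w" "w \<in> W"
      using UVW by (meson completionE)
    show ?thesis
      by (rule LIMSEQ_le[OF completion_dist_lim[OF UVW(1,3) uvw(2,6)]
            tendsto_add[OF completion_dist_lim[OF UVW(1,2) uvw(2,4)]
              completion_dist_lim[OF UVW(2,3) uvw(4,6)]]])
         (use uvw in \<open>auto intro!: triangle MCauchy_in\<close>)
  qed
qed

lemma completion_embed_in: "x \<in> M \<Longrightarrow> completion_embed x \<in> completion"
  by (simp add: completion_embed_def completion_def quotientI)

lemma completion_embed_mem: "x \<in> M \<Longrightarrow> (\<lambda>n. x) \<in> completion_embed x"
  by (simp add: completion_embed_def completion_rel_def)

lemma completion_embed_isometry: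
  "x \<in> M \<Longrightarrow> y \<in> M \<Longrightarrow> completion_dist (completion_embed x) (completion_embed y) = d x y"
  by (rule completion_dist_eqI[OF completion_embed_in completion_embed_in
        completion_embed_mem completion_embed_mem]) auto

lemma completion_embed_tendsto:
  assumes "U \<in> completion" "u \<in> U" "e > 0"
  shows "\<exists>N. \<forall>n\<ge>N. completion_dist U (completion_embed (u n)) < e"
proof -
  have u: "MCauchy u"
    using assms by (auto elim!: completionE simp: completion_rel_def)
  obtain N where N: "\<And>n n'. N \<le> n \<Longrightarrow> N \<le> n' \<Longrightarrow> d (u n) (u n') < e / 2"
    using u assms(3) unfolding MCauchy_def by (meson half_gt_zero)
  have "completion_dist U (completion_embed (u n)) < e" if "n \<ge> N" for n
  proof -
    have "(\<lambda>k. d (u k) (u n)) \<longlonglongrightarrow> completion_dist U (completion_embed (u n))"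
      using completion_dist_lim[OF assms(1) completion_embed_in assms(2) completion_embed_mem]
        u MCauchy_in by blast
    then have "completion_dist U (completion_embed (u n)) \<le> e / 2"
      by (rule LIMSEQ_le_const2) (use N that in \<open>auto intro!: exI[of _ N] less_imp_le\<close>)
    with assms(3) show ?thesis by linarith
  qed
  then show ?thesis by blast
qed

lemma mcomplete_completion: "Metric_space.mcomplete completion completion_dist"
proof -
  interpret C: Metric_space completion completion_dist by (rule Metric_space_completion)
  show ?thesis unfolding C.mcomplete_def
  proof (intro allI impI)
    fix S assume S: "C.MCauchy S"
    have Sin: "S n \<in> completion" for n using S by (rule C.MCauchy_in)
    have "\<exists>x\<in>M. completion_dist (S n) (completion_embed x) < 1 / Suc n" for n
    proof -
      obtain u where "MCauchy u" "u \<in> S n" using Sin by (meson completionE)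
      with completion_embed_tendsto[OF Sin, of u n "1 / Suc n"] show ?thesis
        using MCauchy_in by auto
    qed
    then obtain x where x: "\<And>n. x n \<in> M"
      and xS: "\<And>n. completion_dist (S n) (completion_embed (x n)) < 1 / Suc n" by metis
    have near: "\<exists>N. \<forall>n\<ge>N. completion_dist (S n) (completion_embed (x n)) < e" if "e > 0" for e
    proof -
      obtain N where N: "1 / Suc N < e" using \<open>e > 0\<close> nat_approx_posE by blast
      have "1 / Suc n \<le> 1 / Suc N" if "n \<ge> N" for n using that by (simp add: frac_le)
      with N xS show ?thesis by (meson less_le_trans less_trans)
    qed
    have xC: "MCauchy x" unfolding MCauchy_def
    proof (intro conjI allI impI)
      show "range x \<subseteq> M" using x by auto
      fix e :: real assume "e > 0"
      then obtain N1 N2 where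
        N1: "\<And>n. n \<ge> N1 \<Longrightarrow> completion_dist (S n) (completion_embed (x n)) < e/3" and
        N2: "\<And>n n'. N2 \<le> n \<Longrightarrow> N2 \<le> n' \<Longrightarrow> completion_dist (S n) (S n') < e/3"
        using near[of "e/3"] S unfolding C.MCauchy_def
        by (metis divide_pos_pos zero_less_numeral)
      show "\<exists>N. \<forall>n n'. N \<le> n \<longrightarrow> N \<le> n' \<longrightarrow> d (x n) (x n') < e"
      proof (intro exI[of _ "max N1 N2"] allI impI)
        fix n m assume nm: "max N1 N2 \<le> n" "max N1 N2 \<le> m"
        have "d (x n) (x m) = completion_dist (completion_embed (x n)) (completion_embed (x m))"
          by (simp add: completion_embed_isometry x)
        moreover have "\<bar>completion_dist (S n) (S m)
              - completion_dist (completion_embed (x n)) (completion_embed (x m))\<bar>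
            \<le> completion_dist (S n) (completion_embed (x n))
              + completion_dist (S m) (completion_embed (x m))"
          by (intro C.quadrangle Sin completion_embed_in x)
        ultimately show "d (x n) (x m) < e"
          using N1[of n] N1[of m] N2[of n m] nm by auto
      qed
    qed
    define L where "L = completion_rel `` {x}"
    have L: "L \<in> completion" "x \<in> L"
      using xC equiv_class_self[OF equiv_completion_rel] unfolding L_def completion_def
      by (auto intro!: quotientI)
    show "\<exists>L. limitin C.mtopology S L sequentially"
    proof (intro exI[of _ L], unfold C.limitin_metric, intro conjI L allI impI)
      fix e :: real assume "e > 0"
      then obtain N1 N2 where
        N1: "\<And>n. n \<ge> N1 \<Longrightarrow> completion_dist (S n) (completion_embed (x n)) < e/2" and
        N2: "\<And>n. n \<ge> N2 \<Longrightarrow> completion_dist L (completion_embed (x n)) < e/2"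
        using near[of "e/2"] completion_embed_tendsto[OF L, of "e/2"]
        by (metis half_gt_zero)
      have "completion_dist (S n) L < e" if "n \<ge> max N1 N2" for n
        using N1[of n] N2[of n] that
          C.triangle'[OF Sin[of n] completion_embed_in[OF x[of n]] L(1)] by auto
      then show "\<forall>\<^sub>F n in sequentially. S n \<in> completion \<and> completion_dist (S n) L < e"
        using Sin eventually_sequentially by blast
    qed
  qed
qed

end


section \<open>Quasi *-algebras\<close>

text \<open>The vector space \<open>\<AA>\<close> is the whole type and \<open>A0\<close> is the *-algebra contained in it. Since both
  module multiplications extend the multiplication of \<open>A0\<close>, all three are one partial
  multiplication \<open>mul\<close>, of which only the values with at least one factor in \<open>A0\<close> are
  constrained or used. There need not be a unit.\<close>

locale quasi_star_algebra = vector_space sc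
  for sc :: "complex \<Rightarrow> 'a::ab_group_add \<Rightarrow> 'a" +
  fixes A0 :: "'a set"
    and mul :: "'a \<Rightarrow> 'a \<Rightarrow> 'a"
    and star :: "'a \<Rightarrow> 'a"
  assumes subspace_A0: "subspace A0"
    and mult_closed: "\<lbrakk>x \<in> A0; y \<in> A0\<rbrakk> \<Longrightarrow> mul x y \<in> A0"
    and star_closed: "x \<in> A0 \<Longrightarrow> star x \<in> A0"
    and star_add: "star (a + b) = star a + star b"
    and star_scale: "star (sc c a) = sc (cnj c) (star a)"
    and star_star: "star (star a) = a"
    and right_add: "x \<in> A0 \<Longrightarrow> mul (a + b) x = mul a x + mul b x"
    and right_add_A0: "\<lbrakk>x \<in> A0; y \<in> A0\<rbrakk> \<Longrightarrow> mul a (x + y) = mul a x + mul a y"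
    and right_scale: "x \<in> A0 \<Longrightarrow> mul (sc c a) x = sc c (mul a x)"
    and right_scale_A0: "x \<in> A0 \<Longrightarrow> mul a (sc c x) = sc c (mul a x)"
    and left_add: "x \<in> A0 \<Longrightarrow> mul x (a + b) = mul x a + mul x b"
    and left_add_A0: "\<lbrakk>x \<in> A0; y \<in> A0\<rbrakk> \<Longrightarrow> mul (x + y) a = mul x a + mul y a"
    and left_scale: "x \<in> A0 \<Longrightarrow> mul x (sc c a) = sc c (mul x a)"
    and left_scale_A0: "x \<in> A0 \<Longrightarrow> mul (sc c x) a = sc c (mul x a)"
    and right_assoc: "\<lbrakk>x \<in> A0; y \<in> A0\<rbrakk> \<Longrightarrow> mul a (mul x y) = mul (mul a x) y"
    and left_assoc: "\<lbrakk>x \<in> A0; y \<in> A0\<rbrakk> \<Longrightarrow> mul x (mul y a) = mul (mul x y) a"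
    and mid_assoc: "\<lbrakk>x \<in> A0; y \<in> A0\<rbrakk> \<Longrightarrow> mul (mul x a) y = mul x (mul a y)"
    and star_mult: "x \<in> A0 \<Longrightarrow> star (mul a x) = mul (star x) (star a)"
    and right_faithful: "(\<And>x. x \<in> A0 \<Longrightarrow> mul a x = 0) \<Longrightarrow> a = 0"
    and A0_faithful: "\<lbrakk>x \<in> A0; \<And>a. mul a x = 0\<rbrakk> \<Longrightarrow> x = 0"


section \<open>Positive sesquilinear forms and their Hilbert spaces\<close>

definition sesquilinear ::
    "(complex \<Rightarrow> 'a \<Rightarrow> 'a) \<Rightarrow> ('a::ab_group_add \<Rightarrow> 'a \<Rightarrow> complex) \<Rightarrow> bool" where
  "sesquilinear sc \<phi> \<longleftrightarrow>
     (\<forall>a b c. \<phi> (a + b) c = \<phi> a c + \<phi> b c) \<and>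
     (\<forall>a b c. \<phi> a (b + c) = \<phi> a b + \<phi> a c) \<and>
     (\<forall>z a b. \<phi> (sc z a) b = z * \<phi> a b) \<and>
     (\<forall>z a b. \<phi> a (sc z b) = cnj z * \<phi> a b)"

text \<open>Inequalities between complex numbers, here and below, refer to the order of
  \<^theory>\<open>HOL-Library.Complex_Order\<close>: \<open>z \<le> w\<close> includes \<open>Im z = Im w\<close>, so \<open>0 \<le> z\<close> says that \<open>z\<close> is
  real and nonnegative.\<close>

definition Q_forms ::
    "(complex \<Rightarrow> 'a \<Rightarrow> 'a) \<Rightarrow> 'a set \<Rightarrow> ('a \<Rightarrow> 'a \<Rightarrow> 'a) \<Rightarrow> ('a \<Rightarrow> 'a) \<Rightarrow>
     ('a::ab_group_add \<Rightarrow> 'a \<Rightarrow> complex) set" where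
  "Q_forms sc A0 mul star =
     {\<phi>. sesquilinear sc \<phi> \<and> (\<forall>a. 0 \<le> \<phi> a a) \<and>
         (\<forall>a. \<forall>x\<in>A0. \<forall>y\<in>A0. \<phi> (mul a x) y = \<phi> x (mul (star a) y))}"

definition null_space :: "('a \<Rightarrow> 'a \<Rightarrow> complex) \<Rightarrow> 'a set" where
  "null_space \<phi> = {a. \<phi> a a = 0}"

definition quot_map :: "('a::ab_group_add \<Rightarrow> 'a \<Rightarrow> complex) \<Rightarrow> 'a \<Rightarrow> 'a set" where
  "quot_map \<phi> a = {b. b - a \<in> null_space \<phi>}"

definition quot_inner ::
    "('a::ab_group_add \<Rightarrow> 'a \<Rightarrow> complex) \<Rightarrow> 'a set \<Rightarrow> 'a set \<Rightarrow> complex" where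
  "quot_inner \<phi> X Y = (THE z. \<exists>a\<in>X. \<exists>b\<in>Y. z = \<phi> a b)"

definition quot_norm :: "('a::ab_group_add \<Rightarrow> 'a \<Rightarrow> complex) \<Rightarrow> 'a set \<Rightarrow> real" where
  "quot_norm \<phi> X = sqrt (Re (quot_inner \<phi> X X))"

text \<open>The elementwise difference of two cosets is their difference in the quotient space. Off the
  quotient space the distance is \<open>0\<close>, as the locale \<^locale>\<open>Metric_space\<close> demands.\<close>

definition quot_dist ::
    "('a::ab_group_add \<Rightarrow> 'a \<Rightarrow> complex) \<Rightarrow> 'a set \<Rightarrow> 'a set \<Rightarrow> real" where
  "quot_dist \<phi> X Y =
     (if X \<in> range (quot_map \<phi>) \<and> Y \<in> range (quot_map \<phi>)
      then quot_norm \<phi> {a - b |a b. a \<in> X \<and> b \<in> Y} else 0)"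

text \<open>The Hilbert space completion is taken as the metric completion for the norm distance. This
  carries everything needed here: only the norm topology enters into density.\<close>

definition H_space :: "('a::ab_group_add \<Rightarrow> 'a \<Rightarrow> complex) \<Rightarrow> (nat \<Rightarrow> 'a set) set set" where
  "H_space \<phi> = Metric_space.completion (range (quot_map \<phi>)) (quot_dist \<phi>)"

definition H_dist ::
    "('a::ab_group_add \<Rightarrow> 'a \<Rightarrow> complex) \<Rightarrow> (nat \<Rightarrow> 'a set) set \<Rightarrow> (nat \<Rightarrow> 'a set) set \<Rightarrow> real" where
  "H_dist \<phi> = Metric_space.completion_dist (range (quot_map \<phi>)) (quot_dist \<phi>)"

definition lam :: "('a::ab_group_add \<Rightarrow> 'a \<Rightarrow> complex) \<Rightarrow> 'a \<Rightarrow> (nat \<Rightarrow> 'a set) set" where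
  "lam \<phi> a = Metric_space.completion_embed (range (quot_map \<phi>)) (quot_dist \<phi>) (quot_map \<phi> a)"

definition I_forms ::
    "(complex \<Rightarrow> 'a \<Rightarrow> 'a) \<Rightarrow> 'a set \<Rightarrow> ('a \<Rightarrow> 'a \<Rightarrow> 'a) \<Rightarrow> ('a \<Rightarrow> 'a) \<Rightarrow>
     ('a::ab_group_add \<Rightarrow> 'a \<Rightarrow> complex) set" where
  "I_forms sc A0 mul star =
     {\<phi> \<in> Q_forms sc A0 mul star.
        Metric_space.mtopology (H_space \<phi>) (H_dist \<phi>) closure_of (lam \<phi> ` A0) = H_space \<phi>}"

text \<open>The remaining lemmas confirm that a positive sesquilinear form does turn the quotient into a
  metric space with the expected distance, so that the constructions above are meaningful.\<close>

context
  fixes sc :: "complex \<Rightarrow> 'a::ab_group_add \<Rightarrow> 'a" and \<phi> :: "'a \<Rightarrow> 'a \<Rightarrow> complex"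
  assumes sesq: "sesquilinear sc \<phi>" and pos: "\<And>a. 0 \<le> \<phi> a a"
begin

lemma form_simps:
  "\<phi> (a + b) c = \<phi> a c + \<phi> b c" "\<phi> a (b + c) = \<phi> a b + \<phi> a c"
  "\<phi> (sc z a) b = z * \<phi> a b" "\<phi> a (sc z b) = cnj z * \<phi> a b"
  using sesq unfolding sesquilinear_def by blast+

lemma form_diff: "\<phi> (a - b) c = \<phi> a c - \<phi> b c" "\<phi> a (b - c) = \<phi> a b - \<phi> a c"
  using form_simps(1)[of "a - b" b c] form_simps(2)[of a "b - c" c] by simp_all

lemma form_real: "Im (\<phi> a a) = 0" "Re (\<phi> a a) \<ge> 0"
  using pos[of a] by (auto simp: less_eq_complex_def)

lemma form_hermitian: "\<phi> b a = cnj (\<phi> a b)"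
proof -
  have "Im (\<phi> (a + b) (a + b)) = 0" "Im (\<phi> (a + sc \<i> b) (a + sc \<i> b)) = 0"
    by (rule form_real)+
  then show ?thesis by (auto simp: form_simps form_real complex_eq_iff)
qed

lemma form_Cauchy_Schwarz: "cmod (\<phi> a b) \<le> sqrt (Re (\<phi> a a)) * sqrt (Re (\<phi> b b))"
proof -
  define p q z where "p = Re (\<phi> a a)" and "q = Re (\<phi> b b)" and "z = \<phi> a b"
  have paa: "\<phi> a a = of_real p" and pbb: "\<phi> b b = of_real q"
    using form_real by (auto simp: p_def q_def complex_eq_iff)
  have pq: "p \<ge> 0" "q \<ge> 0" using form_real by (auto simp: p_def q_def)
  have key: "0 \<le> p - 2 * t * (cmod z)\<^sup>2 + t\<^sup>2 * (cmod z)\<^sup>2 * q" for t :: real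
  proof -
    define w where "w = of_real t * z"
    have "\<phi> (a - sc w b) (a - sc w b)
        = of_real p - cnj w * z - w * cnj z + w * cnj w * of_real q"
      by (simp add: form_diff form_simps paa pbb form_hermitian[of b a] z_def algebra_simps)
    also have "\<dots> = of_real (p - 2 * t * (cmod z)\<^sup>2 + t\<^sup>2 * (cmod z)\<^sup>2 * q)"
      by (simp add: w_def complex_eq_iff cmod_power2 algebra_simps)
        (simp add: power2_eq_square algebra_simps)
    finally show ?thesis using form_real(2)[of "a - sc w b"] by simp
  qed
  have "(cmod z)\<^sup>2 \<le> p * q"
  proof (cases "q = 0")
    case True
    have "(cmod z)\<^sup>2 = 0"
    proof (rule ccontr)
      assume "(cmod z)\<^sup>2 \<noteq> 0"
      then have "0 \<le> p - (p + 1)" using key[of "(p + 1) / (2 * (cmod z)\<^sup>2)"] True by simp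
      then show False by simp
    qed
    then show ?thesis using True by simp
  next
    case False
    have "0 \<le> p - 2 * (1/q) * (cmod z)\<^sup>2 + (1/q)\<^sup>2 * (cmod z)\<^sup>2 * q" by (rule key)
    also have "\<dots> = p - (cmod z)\<^sup>2 / q" using False by (simp add: field_simps power2_eq_square)
    finally show ?thesis using False pq by (simp add: field_simps)
  qed
  then show ?thesis
    by (simp add: p_def q_def z_def real_le_rsqrt flip: real_sqrt_mult)
qed

lemma form_triangle:
  "sqrt (Re (\<phi> (a + b) (a + b))) \<le> sqrt (Re (\<phi> a a)) + sqrt (Re (\<phi> b b))"
proof (rule real_le_lsqrt)
  have "Re (\<phi> (a + b) (a + b)) = Re (\<phi> a a) + 2 * Re (\<phi> a b) + Re (\<phi> b b)"
    by (simp add: form_simps form_hermitian[of b a])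
  also have "\<dots> \<le> Re (\<phi> a a) + 2 * (sqrt (Re (\<phi> a a)) * sqrt (Re (\<phi> b b))) + Re (\<phi> b b)"
    using form_Cauchy_Schwarz[of a b] complex_Re_le_cmod[of "\<phi> a b"] by linarith
  also have "\<dots> = (sqrt (Re (\<phi> a a)) + sqrt (Re (\<phi> b b)))\<^sup>2"
    using form_real by (simp add: power2_sum)
  finally show "Re (\<phi> (a + b) (a + b)) \<le> (sqrt (Re (\<phi> a a)) + sqrt (Re (\<phi> b b)))\<^sup>2" .
qed (simp add: form_real)

lemma null_space_iff: "n \<in> null_space \<phi> \<longleftrightarrow> (\<forall>b. \<phi> n b = 0 \<and> \<phi> b n = 0)"
proof
  assume "n \<in> null_space \<phi>"
  then have "cmod (\<phi> n b) \<le> 0" for b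
    using form_Cauchy_Schwarz[of n b] by (simp add: null_space_def)
  then show "\<forall>b. \<phi> n b = 0 \<and> \<phi> b n = 0" using form_hermitian by (metis complex_cnj_zero norm_le_zero_iff)
qed (simp add: null_space_def)

lemma null_space_diff: "m \<in> null_space \<phi> \<Longrightarrow> n \<in> null_space \<phi> \<Longrightarrow> m - n \<in> null_space \<phi>"
  by (auto simp: null_space_iff form_diff)

lemma null_space_zero: "0 \<in> null_space \<phi>"
  using form_diff(1)[of 0 0 0] by (simp add: null_space_def)

lemma quot_map_self: "a \<in> quot_map \<phi> a"
  by (simp add: quot_map_def null_space_zero)

lemma quot_map_eq_iff: "quot_map \<phi> a = quot_map \<phi> b \<longleftrightarrow> a - b \<in> null_space \<phi>"
proof
  show "quot_map \<phi> a = quot_map \<phi> b \<Longrightarrow> a - b \<in> null_space \<phi>"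
    using quot_map_self[of a] by (auto simp: quot_map_def)
  assume "a - b \<in> null_space \<phi>"
  then have "\<phi> a c = \<phi> b c" "\<phi> c a = \<phi> c b" for c by (auto simp: null_space_iff form_diff)
  then show "quot_map \<phi> a = quot_map \<phi> b" by (auto simp: quot_map_def null_space_iff form_diff)
qed

lemma quot_map_diff:
  "{x - y |x y. x \<in> quot_map \<phi> a \<and> y \<in> quot_map \<phi> b} = quot_map \<phi> (a - b)"
proof (intro equalityI subsetI)
  fix c assume "c \<in> {x - y |x y. x \<in> quot_map \<phi> a \<and> y \<in> quot_map \<phi> b}"
  then obtain x y where c: "c = x - y" "x - a \<in> null_space \<phi>" "y - b \<in> null_space \<phi>"
    by (auto simp: quot_map_def)
  have "c - (a - b) = (x - a) - (y - b)" using c by (simp add: algebra_simps)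
  then show "c \<in> quot_map \<phi> (a - b)"
    unfolding quot_map_def using null_space_diff[OF c(2,3)] by (metis mem_Collect_eq)
next
  fix c assume "c \<in> quot_map \<phi> (a - b)"
  then have "c + b \<in> quot_map \<phi> a" "c = (c + b) - b"
    by (auto simp: quot_map_def algebra_simps)
  then show "c \<in> {x - y |x y. x \<in> quot_map \<phi> a \<and> y \<in> quot_map \<phi> b}"
    using quot_map_self by blast
qed

lemma quot_inner_quot_map: "quot_inner \<phi> (quot_map \<phi> a) (quot_map \<phi> b) = \<phi> a b"
  unfolding quot_inner_def
proof (rule the_equality)
  show "\<exists>x\<in>quot_map \<phi> a. \<exists>y\<in>quot_map \<phi> b. \<phi> a b = \<phi> x y" using quot_map_self by blast
  fix z assume "\<exists>x\<in>quot_map \<phi> a. \<exists>y\<in>quot_map \<phi> b. z = \<phi> x y"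
  then show "z = \<phi> a b" by (auto simp: quot_map_def null_space_iff form_diff)
qed

lemma quot_dist_quot_map:
  "quot_dist \<phi> (quot_map \<phi> a) (quot_map \<phi> b) = sqrt (Re (\<phi> (a - b) (a - b)))"
  by (simp add: quot_dist_def quot_norm_def quot_map_diff quot_inner_quot_map)

lemma Metric_space_quot: "Metric_space (range (quot_map \<phi>)) (quot_dist \<phi>)"
proof
  fix X Y
  show "0 \<le> quot_dist \<phi> X Y"
    by (cases "X \<in> range (quot_map \<phi>) \<and> Y \<in> range (quot_map \<phi>)")
       (auto simp: quot_dist_quot_map form_real, auto simp: quot_dist_def)
  show "quot_dist \<phi> X Y = quot_dist \<phi> Y X"
    by (cases "X \<in> range (quot_map \<phi>) \<and> Y \<in> range (quot_map \<phi>)")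
       (auto simp: quot_dist_quot_map form_diff, auto simp: quot_dist_def)
next
  fix X Y assume "X \<in> range (quot_map \<phi>)" "Y \<in> range (quot_map \<phi>)"
  then obtain a b where "X = quot_map \<phi> a" "Y = quot_map \<phi> b" by auto
  then show "quot_dist \<phi> X Y = 0 \<longleftrightarrow> X = Y"
    by (simp add: quot_dist_quot_map quot_map_eq_iff null_space_def complex_eq_iff form_real)
next
  fix X Y Z
  assume "X \<in> range (quot_map \<phi>)" "Y \<in> range (quot_map \<phi>)" "Z \<in> range (quot_map \<phi>)"
  then obtain a b c where "X = quot_map \<phi> a" "Y = quot_map \<phi> b" "Z = quot_map \<phi> c" by auto
  then show "quot_dist \<phi> X Z \<le> quot_dist \<phi> X Y + quot_dist \<phi> Y Z"
    using form_triangle[of "a - b" "b - c"] by (simp add: quot_dist_quot_map)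
qed

end


section \<open>Sufficient families and boundedness\<close>

definition form_translate ::
    "('a \<Rightarrow> 'a \<Rightarrow> 'a) \<Rightarrow> ('a \<Rightarrow> 'a \<Rightarrow> complex) \<Rightarrow> 'a \<Rightarrow> 'a \<Rightarrow> 'a \<Rightarrow> complex" where
  "form_translate mul \<phi> x = (\<lambda>a b. \<phi> (mul a x) (mul b x))"

definition balanced ::
    "'a set \<Rightarrow> ('a \<Rightarrow> 'a \<Rightarrow> 'a) \<Rightarrow> ('a \<Rightarrow> 'a \<Rightarrow> complex) set \<Rightarrow> bool" where
  "balanced A0 mul M \<longleftrightarrow> (\<forall>\<phi>\<in>M. \<forall>x\<in>A0. form_translate mul \<phi> x \<in> M)"

definition sufficient ::
    "'a::ab_group_add set \<Rightarrow> ('a \<Rightarrow> 'a \<Rightarrow> 'a) \<Rightarrow> ('a \<Rightarrow> 'a \<Rightarrow> complex) set \<Rightarrow> bool" where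
  "sufficient A0 mul M \<longleftrightarrow> balanced A0 mul M \<and> (\<forall>a. a \<noteq> 0 \<longrightarrow> (\<exists>\<phi>\<in>M. 0 < \<phi> a a))"

definition re_part ::
    "(complex \<Rightarrow> 'a \<Rightarrow> 'a) \<Rightarrow> ('a \<Rightarrow> 'a) \<Rightarrow> 'a::ab_group_add \<Rightarrow> 'a" where
  "re_part sc star a = sc (1 / 2) (a + star a)"

definition im_part ::
    "(complex \<Rightarrow> 'a \<Rightarrow> 'a) \<Rightarrow> ('a \<Rightarrow> 'a) \<Rightarrow> 'a::ab_group_add \<Rightarrow> 'a" where
  "im_part sc star a = sc (1 / (2 * \<i>)) (a - star a)"

definition K_bounded ::
    "(complex \<Rightarrow> 'a \<Rightarrow> 'a) \<Rightarrow> 'a set \<Rightarrow> ('a \<Rightarrow> 'a \<Rightarrow> 'a) \<Rightarrow> ('a \<Rightarrow> 'a) \<Rightarrow>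
     ('a::ab_group_add \<Rightarrow> 'a \<Rightarrow> complex) set \<Rightarrow> 'a \<Rightarrow> bool" where
  "K_bounded sc A0 mul star M a \<longleftrightarrow>
     (\<exists>\<gamma>::real. \<gamma> \<ge> 0 \<and> (\<forall>\<phi>\<in>M. \<forall>x\<in>A0.
        \<phi> (mul (re_part sc star a) x) x \<le> of_real \<gamma> * \<phi> x x \<and>
        - \<phi> (mul (re_part sc star a) x) x \<le> of_real \<gamma> * \<phi> x x \<and>
        \<phi> (mul (im_part sc star a) x) x \<le> of_real \<gamma> * \<phi> x x \<and>
        - \<phi> (mul (im_part sc star a) x) x \<le> of_real \<gamma> * \<phi> x x))"

definition M_bounded ::
    "'a set \<Rightarrow> ('a \<Rightarrow> 'a \<Rightarrow> 'a) \<Rightarrow> ('a \<Rightarrow> 'a \<Rightarrow> complex) set \<Rightarrow> 'a \<Rightarrow> bool" where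
  "M_bounded A0 mul M a \<longleftrightarrow>
     (\<exists>\<gamma>::real. \<gamma> > 0 \<and> (\<forall>\<phi>\<in>M. \<forall>x\<in>A0. \<forall>y\<in>A0.
        cmod (\<phi> (mul a x) y) \<le> \<gamma> * sqrt (Re (\<phi> x x)) * sqrt (Re (\<phi> y y))))"

end

theory Submission
  imports Defs
begin

text \<open>
  Fix \<open>\<phi>\<close> in the family and write \<open>\<parallel>b\<parallel>\<close> for the seminorm \<open>\<phi>(b, b)\<^sup>1\<^sup>/\<^sup>2\<close>. All four conditions speak
  about the operator \<open>x \<mapsto> a x\<close> from \<open>A0\<close> to the Hilbert space of \<open>\<phi>\<close>; they are equivalent for a
  single \<open>\<phi>\<close>, with constants that do not depend on \<open>\<phi>\<close>, and this independence lets the equivalences pass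
  to the whole family.

  \<^item> Since \<open>\<phi>(a\<^sup>* x, x)\<close> is the complex conjugate of \<open>\<phi>(a x, x)\<close>, the numbers \<open>\<phi>(\<Re>(a) x, x)\<close> and
    \<open>\<phi>(\<Im>(a) x, x)\<close> are the real and the imaginary part of \<open>\<phi>(a x, x)\<close>
    (\<open>form_re_part\<close>, \<open>form_im_part\<close>). So a bound on both is a bound on the modulus of
    \<open>\<phi>(a x, x)\<close>, up to a factor \<open>2\<close>.

  \<^item> A bound on the quadratic form \<open>\<phi>(a x, x)\<close> becomes a bound on \<open>\<phi>(a x, y)\<close> by polarization,
    where the four diagonal terms add up, by the parallelogram law, to a multiple of
    \<open>\<parallel>x\<parallel>\<^sup>2 + \<parallel>y\<parallel>\<^sup>2\<close>; replacing \<open>x, y\<close> by \<open>t x, y / t\<close> and optimising over \<open>t\<close> turns this sum into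
    the product \<open>2 \<parallel>x\<parallel> \<parallel>y\<parallel>\<close> (\<open>polarized_bound\<close>).

  \<^item> A bound \<open>\<bar>\<phi>(b, y)\<bar> \<le> C \<parallel>y\<parallel>\<close> for \<open>y\<close> in \<open>A0\<close> gives \<open>\<parallel>b\<parallel> \<le> C\<close>, because the image of \<open>A0\<close> is
    dense in the Hilbert space (\<open>form_norm_le_of_dense\<close>). For \<open>b = a x\<close> this bounds \<open>\<parallel>a x\<parallel>\<close>; the
    converse is the Cauchy-Schwarz inequality.
\<close>

section \<open>The seminorm of a positive form\<close>

definition form_norm :: "('a \<Rightarrow> 'a \<Rightarrow> complex) \<Rightarrow> 'a \<Rightarrow> real" where
  "form_norm \<phi> b = sqrt (Re (\<phi> b b))"

context
  fixes sc :: "complex \<Rightarrow> 'a::ab_group_add \<Rightarrow> 'a" and \<phi> :: "'a \<Rightarrow> 'a \<Rightarrow> complex"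
  assumes sesq: "sesquilinear sc \<phi>" and pos: "\<And>a. 0 \<le> \<phi> a a"
begin

lemma form_norm_nonneg: "0 \<le> form_norm \<phi> b"
  by (simp add: form_norm_def form_real[OF sesq pos])

lemma form_norm_square: "(form_norm \<phi> b)\<^sup>2 = Re (\<phi> b b)"
  by (simp add: form_norm_def form_real[OF sesq pos])

lemma form_self_eq: "\<phi> b b = of_real ((form_norm \<phi> b)\<^sup>2)"
  by (simp add: form_norm_square complex_eq_iff form_real[OF sesq pos])

lemma form_norm_scale: "form_norm \<phi> (sc c b) = cmod c * form_norm \<phi> b"
proof -
  have "\<phi> (sc c b) (sc c b) = of_real ((cmod c)\<^sup>2 * (form_norm \<phi> b)\<^sup>2)"
    unfolding form_simps[OF sesq pos] form_self_eq[of b] of_real_mult complex_norm_square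
    by (simp only: mult.assoc mult.left_commute)
  then show ?thesis
    by (simp add: form_norm_def[of \<phi> "sc c b"] real_sqrt_mult form_norm_nonneg)
qed

lemma form_bound: "cmod (\<phi> b c) \<le> form_norm \<phi> b * form_norm \<phi> c"
  using form_Cauchy_Schwarz[OF sesq pos] by (simp add: form_norm_def)

lemma form_norm_add: "form_norm \<phi> (b + c) \<le> form_norm \<phi> b + form_norm \<phi> c"
  using form_triangle[OF sesq pos] by (simp add: form_norm_def)

text \<open>The embedding of the algebra in the Hilbert space is isometric for the seminorm, so topological
  density there is approximation in the seminorm.\<close>

lemma form_norm_dense:
  assumes dense: "Metric_space.mtopology (H_space \<phi>) (H_dist \<phi>) closure_of (lam \<phi> ` S) = H_space \<phi>"
    and "e > 0"
  obtains y where "y \<in> S" "form_norm \<phi> (b - y) < e"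
proof -
  interpret Q: Metric_space "range (quot_map \<phi>)" "quot_dist \<phi>"
    by (rule Metric_space_quot[OF sesq pos])
  interpret H: Metric_space "H_space \<phi>" "H_dist \<phi>"
    unfolding H_space_def H_dist_def by (rule Q.Metric_space_completion)
  have "lam \<phi> b \<in> H_space \<phi>"
    by (simp add: H_space_def lam_def Q.completion_embed_in)
  then have "lam \<phi> b \<in> H.mtopology closure_of (lam \<phi> ` S)"
    using dense by simp
  then obtain y where y: "y \<in> S" "H_dist \<phi> (lam \<phi> b) (lam \<phi> y) < e"
    using \<open>e > 0\<close> by (force simp: H.metric_closure_of)
  have "H_dist \<phi> (lam \<phi> b) (lam \<phi> y) = form_norm \<phi> (b - y)"
    by (simp add: H_dist_def lam_def Q.completion_embed_isometry quot_dist_quot_map[OF sesq pos]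
        form_norm_def)
  with y that show thesis by simp
qed

text \<open>A vector is as long as the functional it represents, and a dense subspace suffices to compute
  the norm of that functional.\<close>

lemma form_norm_le_of_dense:
  assumes dense: "Metric_space.mtopology (H_space \<phi>) (H_dist \<phi>) closure_of (lam \<phi> ` S) = H_space \<phi>"
    and bound: "\<And>y. y \<in> S \<Longrightarrow> cmod (\<phi> b y) \<le> C * form_norm \<phi> y"
    and "C \<ge> 0"
  shows "form_norm \<phi> b \<le> C"
proof -
  let ?r = "form_norm \<phi> b"
  have "?r\<^sup>2 \<le> C * ?r + e" if "e > 0" for e
  proof -
    \<comment> \<open>Replacing \<open>b\<close> by \<open>y\<close> within \<open>d\<close> costs \<open>d * (C + ?r)\<close>; the summand \<open>1\<close> avoids a
      zero denominator.\<close>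
    define d where "d = e / (C + ?r + 1)"
    have den: "C + ?r + 1 > 0" using \<open>C \<ge> 0\<close> form_norm_nonneg[of b] by linarith
    then have "d > 0" using that by (simp add: d_def)
    then obtain y where y: "y \<in> S" and near: "form_norm \<phi> (b - y) < d"
      using form_norm_dense[OF dense] by blast
    have "form_norm \<phi> (y - b) = form_norm \<phi> (b - y)"
      by (simp add: form_norm_def form_diff[OF sesq pos])
    then have ny: "form_norm \<phi> y \<le> ?r + d"
      using form_norm_add[of b "y - b"] near by simp
    have "?r\<^sup>2 = cmod (\<phi> b y + \<phi> b (b - y))"
      by (simp add: form_diff[OF sesq pos] form_self_eq norm_power form_norm_nonneg)
    also have "\<dots> \<le> cmod (\<phi> b y) + cmod (\<phi> b (b - y))"
      by (rule norm_triangle_ineq)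
    also have "\<dots> \<le> C * form_norm \<phi> y + ?r * form_norm \<phi> (b - y)"
      by (intro add_mono bound y form_bound)
    also have "\<dots> \<le> C * (?r + d) + ?r * d"
      using near ny \<open>C \<ge> 0\<close> form_norm_nonneg[of b] by (intro add_mono mult_left_mono) auto
    also have "\<dots> \<le> C * ?r + d * (C + ?r + 1)"
      using \<open>d > 0\<close> by (simp add: algebra_simps)
    also have "\<dots> = C * ?r + e"
      using den by (simp add: d_def)
    finally show ?thesis .
  qed
  then have "?r\<^sup>2 \<le> C * ?r"
    by (rule field_le_epsilon)
  then show ?thesis
    using form_norm_nonneg[of b] \<open>C \<ge> 0\<close> by (cases "?r = 0") (auto simp: power2_eq_square)
qed

end

section \<open>Polarization\<close>

text \<open>The left-hand side is at least its value \<open>2 * p * q\<close> at \<open>t = q / p\<close>. The positive number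
  \<open>e\<close> keeps this choice of \<open>t\<close> meaningful when \<open>p\<close> or \<open>q\<close> vanishes.\<close>

lemma le_product_of_le_weighted_sum:
  fixes p q z K :: real
  assumes "p \<ge> 0" "q \<ge> 0" "K \<ge> 0"
    and weighted: "\<And>t. t > 0 \<Longrightarrow> z \<le> K * (t * p\<^sup>2 + q\<^sup>2 / t)"
  shows "z \<le> 2 * K * (p * q)"
proof -
  have "z \<le> 2 * K * ((p + e) * (q + e))" if "e > 0" for e
  proof -
    define t where "t = (q + e) / (p + e)"
    have pe: "p + e > 0" and qe: "q + e > 0" using assms that by auto
    then have "t > 0" by (simp add: t_def)
    then have "z \<le> K * (t * p\<^sup>2 + q\<^sup>2 / t)" by (rule weighted)
    also have "\<dots> \<le> K * (t * (p + e)\<^sup>2 + (q + e)\<^sup>2 / t)"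
      using assms that \<open>t > 0\<close>
      by (intro mult_left_mono add_mono divide_right_mono power_mono) auto
    also have "t * (p + e)\<^sup>2 + (q + e)\<^sup>2 / t = 2 * ((p + e) * (q + e))"
      using pe qe by (simp add: t_def power2_eq_square)
    finally show ?thesis by simp
  qed
  moreover have "((\<lambda>e. 2 * K * ((p + e) * (q + e))) \<longlongrightarrow> 2 * K * ((p + 0) * (q + 0))) (at_right 0)"
    by (intro tendsto_intros)
  ultimately have "z \<le> 2 * K * ((p + 0) * (q + 0))"
    by (intro tendsto_lowerbound[where F = "at_right 0"])
      (auto simp: eventually_at_right_less intro: eventually_mono[OF eventually_at_right_less])
  then show ?thesis by simp
qed

context quasi_star_algebra
begin

lemma form_mul_expand:
  assumes "sesquilinear sc \<phi>" "x \<in> A0" "y \<in> A0"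
  shows "\<phi> (mul a (x + sc c y)) (x + sc c y) =
    \<phi> (mul a x) x + cnj c * \<phi> (mul a x) y + c * \<phi> (mul a y) x + c * cnj c * \<phi> (mul a y) y"
proof -
  have "sc c y \<in> A0" using subspace_A0 \<open>y \<in> A0\<close> by (simp add: subspace_def)
  then show ?thesis
    using assms by (simp add: sesquilinear_def right_add_A0 right_scale_A0 algebra_simps)
qed

lemma form_mul_polarization:
  assumes "sesquilinear sc \<phi>" "x \<in> A0" "y \<in> A0"
  shows "4 * \<phi> (mul a x) y =
    (\<Sum>c\<in>{1, -1, \<i>, -\<i>}. c * \<phi> (mul a (x + sc c y)) (x + sc c y))"
  by (simp add: form_mul_expand[OF assms] complex_eq_iff algebra_simps)

lemma form_norm_parallelogram:
  assumes sesq: "sesquilinear sc \<phi>" and pos: "\<And>b. 0 \<le> \<phi> b b"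
  shows "(\<Sum>c\<in>{1, -1, \<i>, -\<i>}. (form_norm \<phi> (x + sc c y))\<^sup>2) =
    4 * ((form_norm \<phi> x)\<^sup>2 + (form_norm \<phi> y)\<^sup>2)"
  by (simp add: form_norm_square[OF sesq pos] form_simps[OF sesq pos] complex_eq_iff algebra_simps)

text \<open>Multiplication by \<open>a\<close> need not be symmetric for \<open>\<phi>\<close>, hence the factor \<open>2\<close> between the
  bound on the diagonal and the bound off it.\<close>

lemma polarized_bound:
  assumes sesq: "sesquilinear sc \<phi>" and pos: "\<And>b. 0 \<le> \<phi> b b" and "K \<ge> 0"
    and diag: "\<And>x. x \<in> A0 \<Longrightarrow> cmod (\<phi> (mul a x) x) \<le> K * (form_norm \<phi> x)\<^sup>2"
    and "x \<in> A0" "y \<in> A0"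
  shows "cmod (\<phi> (mul a x) y) \<le> 2 * K * (form_norm \<phi> x * form_norm \<phi> y)"
proof -
  have scale_A0: "sc c u \<in> A0" if "u \<in> A0" for c u
    using subspace_A0 that by (simp add: subspace_def)
  have sum_bound: "cmod (\<phi> (mul a u) v) \<le> K * ((form_norm \<phi> u)\<^sup>2 + (form_norm \<phi> v)\<^sup>2)"
    if "u \<in> A0" "v \<in> A0" for u v
  proof -
    have diag_c: "cmod (c * \<phi> (mul a (u + sc c v)) (u + sc c v)) \<le> K * (form_norm \<phi> (u + sc c v))\<^sup>2"
      if "cmod c = 1" for c
      using diag[of "u + sc c v"] subspace_A0 \<open>u \<in> A0\<close> \<open>v \<in> A0\<close> that
      by (simp add: norm_mult subspace_def)
    have "4 * cmod (\<phi> (mul a u) v) = cmod (4 * \<phi> (mul a u) v)"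
      by (simp add: norm_mult)
    also have "\<dots> \<le> (\<Sum>c\<in>{1, -1, \<i>, -\<i>}. cmod (c * \<phi> (mul a (u + sc c v)) (u + sc c v)))"
      unfolding form_mul_polarization[OF sesq that]
      by (rule norm_sum)
    also have "\<dots> \<le> (\<Sum>c\<in>{1, -1, \<i>, -\<i>}. K * (form_norm \<phi> (u + sc c v))\<^sup>2)"
      by (intro sum_mono diag_c) auto
    also have "\<dots> = K * (4 * ((form_norm \<phi> u)\<^sup>2 + (form_norm \<phi> v)\<^sup>2))"
      unfolding form_norm_parallelogram[OF sesq pos, symmetric] by (rule sum_distrib_left[symmetric])
    finally show ?thesis by (simp add: algebra_simps)
  qed
  have "cmod (\<phi> (mul a x) y) \<le> K * (t * (form_norm \<phi> x)\<^sup>2 + (form_norm \<phi> y)\<^sup>2 / t)"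
    if "t > 0" for t
  proof -
    \<comment> \<open>With \<open>s * s = t\<close>, passing to \<open>s x\<close> and \<open>y / s\<close> leaves the left-hand side unchanged.\<close>
    define s where "s = sqrt t"
    have s: "s > 0" "s * s = t" using that by (auto simp: s_def)
    have "\<phi> (mul a (sc (of_real s) x)) (sc (of_real (1 / s)) y) = \<phi> (mul a x) y"
      using s by (simp add: right_scale_A0 \<open>x \<in> A0\<close> form_simps[OF sesq pos])
    moreover have "(form_norm \<phi> (sc (of_real s) x))\<^sup>2 = t * (form_norm \<phi> x)\<^sup>2"
      "(form_norm \<phi> (sc (of_real (1 / s)) y))\<^sup>2 = (form_norm \<phi> y)\<^sup>2 / t"
      using s by (auto simp: form_norm_scale[OF sesq pos] power_mult_distrib power2_eq_square
          norm_divide)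
    ultimately show ?thesis
      using sum_bound[of "sc (of_real s) x" "sc (of_real (1 / s)) y"] scale_A0 \<open>x \<in> A0\<close> \<open>y \<in> A0\<close>
      by metis
  qed
  then show ?thesis
    by (intro le_product_of_le_weighted_sum form_norm_nonneg[OF sesq pos] \<open>K \<ge> 0\<close>)
qed

section \<open>Real and imaginary part\<close>

lemma form_mul_star:
  assumes "\<phi> \<in> Q_forms sc A0 mul star" "x \<in> A0"
  shows "\<phi> (mul (star a) x) x = cnj (\<phi> (mul a x) x)"
proof -
  have "sesquilinear sc \<phi>" "\<And>b. 0 \<le> \<phi> b b" "\<phi> (mul a x) x = \<phi> x (mul (star a) x)"
    using assms by (auto simp: Q_forms_def)
  then show ?thesis using form_hermitian by metis
qed

lemma form_re_part:
  assumes "\<phi> \<in> Q_forms sc A0 mul star" "x \<in> A0"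
  shows "\<phi> (mul (re_part sc star a) x) x = of_real (Re (\<phi> (mul a x) x))"
proof -
  have "\<phi> (mul (re_part sc star a) x) x = 1 / 2 * (\<phi> (mul a x) x + \<phi> (mul (star a) x) x)"
    using assms by (simp add: re_part_def Q_forms_def sesquilinear_def right_add right_scale)
  then show ?thesis by (simp add: form_mul_star[OF assms] complex_eq_iff)
qed

lemma mul_diff_left: "x \<in> A0 \<Longrightarrow> mul (b - c) x = mul b x - mul c x"
  using right_add[of x "b - c" c] by simp

lemma form_im_part:
  assumes "\<phi> \<in> Q_forms sc A0 mul star" "x \<in> A0"
  shows "\<phi> (mul (im_part sc star a) x) x = of_real (Im (\<phi> (mul a x) x))"
proof -
  have "sesquilinear sc \<phi>" "\<And>b. 0 \<le> \<phi> b b" using assms by (auto simp: Q_forms_def)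
  then have "\<phi> (mul (im_part sc star a) x) x = 1 / (2 * \<i>) * (\<phi> (mul a x) x - \<phi> (mul (star a) x) x)"
    unfolding im_part_def right_scale[OF assms(2)] mul_diff_left[OF assms(2)]
    by (simp only: form_simps form_diff)
  then show ?thesis by (simp add: form_mul_star[OF assms] complex_eq_iff)
qed

lemma K_bounded_iff:
  assumes "M \<subseteq> Q_forms sc A0 mul star"
  shows "K_bounded sc A0 mul star M a \<longleftrightarrow>
    (\<exists>\<gamma>\<ge>0. \<forall>\<phi>\<in>M. \<forall>x\<in>A0. \<bar>Re (\<phi> (mul a x) x)\<bar> \<le> \<gamma> * Re (\<phi> x x) \<and>
      \<bar>Im (\<phi> (mul a x) x)\<bar> \<le> \<gamma> * Re (\<phi> x x))"
proof -
  have "(\<phi> (mul (re_part sc star a) x) x \<le> of_real \<gamma> * \<phi> x x \<and>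
        - \<phi> (mul (re_part sc star a) x) x \<le> of_real \<gamma> * \<phi> x x \<and>
        \<phi> (mul (im_part sc star a) x) x \<le> of_real \<gamma> * \<phi> x x \<and>
        - \<phi> (mul (im_part sc star a) x) x \<le> of_real \<gamma> * \<phi> x x) \<longleftrightarrow>
      \<bar>Re (\<phi> (mul a x) x)\<bar> \<le> \<gamma> * Re (\<phi> x x) \<and> \<bar>Im (\<phi> (mul a x) x)\<bar> \<le> \<gamma> * Re (\<phi> x x)"
    if "\<phi> \<in> M" "x \<in> A0" for \<phi> x \<gamma>
  proof -
    have "\<phi> \<in> Q_forms sc A0 mul star" using assms that by auto
    moreover from this have "Im (\<phi> x x) = 0"
      by (simp add: Q_forms_def less_eq_complex_def)
    ultimately show ?thesis
      using that by (auto simp: form_re_part form_im_part less_eq_complex_def abs_le_iff)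
  qed
  then show ?thesis unfolding K_bounded_def by (metis (no_types, lifting))
qed

end

section \<open>Equivalence of the boundedness conditions\<close>

theorem theorem4p8:
  fixes sc :: "complex \<Rightarrow> 'a::ab_group_add \<Rightarrow> 'a"
    and A0 :: "'a set"
    and mul :: "'a \<Rightarrow> 'a \<Rightarrow> 'a"
    and star :: "'a \<Rightarrow> 'a"
    and M :: "('a \<Rightarrow> 'a \<Rightarrow> complex) set"
    and a :: 'a
  assumes "quasi_star_algebra sc A0 mul star"
    and "M \<subseteq> I_forms sc A0 mul star"
    and "sufficient A0 mul M"
  shows "(K_bounded sc A0 mul star M a \<longleftrightarrow> M_bounded A0 mul M a) \<and>
    (M_bounded A0 mul M a \<longleftrightarrow>
       (\<exists>\<gamma>::real. \<gamma> > 0 \<and> (\<forall>\<phi>\<in>M. \<forall>x\<in>A0.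
          \<phi> (mul a x) (mul a x) \<le> of_real \<gamma> * \<phi> x x))) \<and>
    (M_bounded A0 mul M a \<longleftrightarrow>
       (\<exists>\<gamma>::real. \<gamma> > 0 \<and> (\<forall>\<phi>\<in>M. \<forall>x\<in>A0.
          cmod (\<phi> (mul a x) x) \<le> \<gamma> * Re (\<phi> x x))))"
    (is "(?K \<longleftrightarrow> ?B) \<and> (?B \<longleftrightarrow> ?N) \<and> (?B \<longleftrightarrow> ?D)")
proof -
  interpret quasi_star_algebra sc A0 mul star by fact
  have MQ: "M \<subseteq> Q_forms sc A0 mul star" using assms(2) by (auto simp: I_forms_def)
  have sesq: "sesquilinear sc \<phi>" and pos: "\<And>b. 0 \<le> \<phi> b b" if "\<phi> \<in> M" for \<phi>
    using MQ that by (auto simp: Q_forms_def)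
  have dense: "Metric_space.mtopology (H_space \<phi>) (H_dist \<phi>) closure_of (lam \<phi> ` A0) = H_space \<phi>"
    if "\<phi> \<in> M" for \<phi>
    using assms(2) that by (auto simp: I_forms_def)
  have norm_nonneg: "0 \<le> form_norm \<phi> b" and norm_sq: "(form_norm \<phi> b)\<^sup>2 = Re (\<phi> b b)"
    and self_real: "Im (\<phi> b b) = 0" and self_nonneg: "0 \<le> Re (\<phi> b b)" if "\<phi> \<in> M" for \<phi> b
    using form_norm_nonneg[OF sesq[OF that] pos[OF that]]
      form_norm_square[OF sesq[OF that] pos[OF that]] form_real[OF sesq[OF that] pos[OF that]]
    by simp_all
  have B_iff: "?B \<longleftrightarrow> (\<exists>\<gamma>>0. \<forall>\<phi>\<in>M. \<forall>x\<in>A0. \<forall>y\<in>A0.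
      cmod (\<phi> (mul a x) y) \<le> \<gamma> * form_norm \<phi> x * form_norm \<phi> y)"
    by (simp add: M_bounded_def form_norm_def)
  have N_iff: "?N \<longleftrightarrow> (\<exists>\<gamma>>0. \<forall>\<phi>\<in>M. \<forall>x\<in>A0. (form_norm \<phi> (mul a x))\<^sup>2 \<le> \<gamma> * (form_norm \<phi> x)\<^sup>2)"
  proof -
    have "\<phi> (mul a x) (mul a x) \<le> of_real \<gamma> * \<phi> x x \<longleftrightarrow>
        (form_norm \<phi> (mul a x))\<^sup>2 \<le> \<gamma> * (form_norm \<phi> x)\<^sup>2" if "\<phi> \<in> M" for \<phi> x and \<gamma> :: real
      using that by (simp add: norm_sq less_eq_complex_def self_real)
    then show ?thesis by simp
  qed
  have "?B \<Longrightarrow> ?N"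
  proof -
    assume ?B
    then obtain \<gamma> where "\<gamma> > 0" and \<gamma>: "\<And>\<phi> x y. \<phi> \<in> M \<Longrightarrow> x \<in> A0 \<Longrightarrow> y \<in> A0 \<Longrightarrow>
        cmod (\<phi> (mul a x) y) \<le> \<gamma> * form_norm \<phi> x * form_norm \<phi> y"
      unfolding B_iff by auto
    have "(form_norm \<phi> (mul a x))\<^sup>2 \<le> \<gamma>\<^sup>2 * (form_norm \<phi> x)\<^sup>2" if "\<phi> \<in> M" "x \<in> A0" for \<phi> x
    proof -
      have "form_norm \<phi> (mul a x) \<le> \<gamma> * form_norm \<phi> x"
        using that \<gamma> \<open>\<gamma> > 0\<close> norm_nonneg
        by (intro form_norm_le_of_dense[OF sesq[OF that(1)] pos[OF that(1)] dense]) auto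
      then show ?thesis
        using power_mono[of "form_norm \<phi> (mul a x)" _ 2] norm_nonneg that
        by (fastforce simp: power_mult_distrib)
    qed
    then show ?N unfolding N_iff using \<open>\<gamma> > 0\<close> by (intro exI[of _ "\<gamma>\<^sup>2"]) auto
  qed
  moreover have "?N \<Longrightarrow> ?B"
  proof -
    assume ?N
    then obtain \<gamma> where "\<gamma> > 0" and \<gamma>: "\<And>\<phi> x. \<phi> \<in> M \<Longrightarrow> x \<in> A0 \<Longrightarrow>
        (form_norm \<phi> (mul a x))\<^sup>2 \<le> \<gamma> * (form_norm \<phi> x)\<^sup>2"
      unfolding N_iff by auto
    have "cmod (\<phi> (mul a x) y) \<le> sqrt \<gamma> * form_norm \<phi> x * form_norm \<phi> y"
      if "\<phi> \<in> M" "x \<in> A0" "y \<in> A0" for \<phi> x y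
    proof -
      have "form_norm \<phi> (mul a x) \<le> sqrt \<gamma> * form_norm \<phi> x"
        using real_sqrt_le_mono[OF \<gamma>] that norm_nonneg
        by (simp add: real_sqrt_mult)
      then show ?thesis
        using form_bound[OF sesq[OF that(1)] pos[OF that(1)], of "mul a x" y] norm_nonneg[of \<phi>] that
        by (meson mult_right_mono order_trans)
    qed
    then show ?B unfolding B_iff using \<open>\<gamma> > 0\<close> by (intro exI[of _ "sqrt \<gamma>"]) auto
  qed
  moreover have "?B \<Longrightarrow> ?D"
    unfolding B_iff by (metis mult.assoc norm_sq power2_eq_square)
  moreover have "?D \<Longrightarrow> ?B"
  proof -
    assume ?D
    then obtain \<gamma> where "\<gamma> > 0" and \<gamma>: "\<And>\<phi> x. \<phi> \<in> M \<Longrightarrow> x \<in> A0 \<Longrightarrow>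
        cmod (\<phi> (mul a x) x) \<le> \<gamma> * (form_norm \<phi> x)\<^sup>2"
      by (auto simp: norm_sq)
    then have "cmod (\<phi> (mul a x) y) \<le> 2 * \<gamma> * form_norm \<phi> x * form_norm \<phi> y"
      if "\<phi> \<in> M" "x \<in> A0" "y \<in> A0" for \<phi> x y
      using polarized_bound[OF sesq[OF that(1)] pos[OF that(1)], of \<gamma> a x y] that by (simp add: mult.assoc)
    then show ?B unfolding B_iff using \<open>\<gamma> > 0\<close> by (intro exI[of _ "2 * \<gamma>"]) auto
  qed
  moreover have "?D \<Longrightarrow> ?K"
    unfolding K_bounded_iff[OF MQ] by (meson abs_Im_le_cmod abs_Re_le_cmod less_imp_le order_trans)
  moreover have "?K \<Longrightarrow> ?D"
  proof -
    assume ?K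
    then obtain \<gamma> where "\<gamma> \<ge> 0" and \<gamma>: "\<And>\<phi> x. \<phi> \<in> M \<Longrightarrow> x \<in> A0 \<Longrightarrow>
        \<bar>Re (\<phi> (mul a x) x)\<bar> \<le> \<gamma> * Re (\<phi> x x) \<and> \<bar>Im (\<phi> (mul a x) x)\<bar> \<le> \<gamma> * Re (\<phi> x x)"
      unfolding K_bounded_iff[OF MQ] by blast
    \<comment> \<open>The summand \<open>1\<close> makes the constant positive also when \<open>\<gamma> = 0\<close>.\<close>
    have "cmod (\<phi> (mul a x) x) \<le> (2 * \<gamma> + 1) * Re (\<phi> x x)" if "\<phi> \<in> M" "x \<in> A0" for \<phi> x
      using cmod_le[of "\<phi> (mul a x) x"] \<gamma>[OF that] self_nonneg[OF that(1), of x]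
      by (simp add: algebra_simps)
    then show ?D using \<open>\<gamma> \<ge> 0\<close> by (intro exI[of _ "2 * \<gamma> + 1"]) auto
  qed
  ultimately show ?thesis by blast
qed

end
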